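(* Let $n\ge d$ and let $\Phi:\mathbb R^d\times\mathbb T^n\to\mathbb T^n$ be a $C^1$ action. If $\Phi$ is expansive and homogeneous then $\mathcal Z^1(\Phi)$ is quasi-trivial, i.e., for every $\Psi\in\mathcal Z^1(\Phi)$ there exists a $C^1$ map $A:\mathbb T^n\to\mathcal M_{d\times d}(\mathbb R)$ satisfying $A(x)=A(\Phi_v(x))$ for every $v\in\mathbb R^d$ and $x\in\mathbb T^n$, and such that $\Psi_v(x)=\Phi(A(x)v,x)$ for every $(v,x)\in\mathbb R^d\times\mathbb T^n$.
   Context: A $C^r$ action is a $C^r$ map $\Phi:\mathbb R^d\times M\to M$ such that each $\Phi_v:=\Phi(v,\cdot)$ is a $C^r$ diffeomorphism of $M$ and $\Phi_{v+u}=\Phi_v\circ\Phi_u$ for all $u,v\in\mathbb R^d$. $\mathbb T^n$ is the $n$-torus and $\mathcal M_{d\times d}(\mathbb R)$ is the space of real $d\times d$ matrices. Expansive: for every $\varepsilon>0$ there is $\delta>0$ such that if $x,y\in M$ satisfy $\mathrm{dist}(\Phi_v(x),\Phi_{h(v)}(y))<\delta$ for every $v\in\mathbb R^d$ for some continuous $h:\mathbb R^d\to\mathbb R^d$ with $h(0)=0$, then $y=\Phi_{v_0}(x)$ for some $v_0\in\mathbb R^d$ with $\|v_0\|<\varepsilon$ ($\|\cdot\|$ is the Euclidean norm). Homogeneous (locally free): all orbits of $\Phi$ are (immersed) submanifolds of $M$ of dimension $d$. Centralizer: $\mathcal Z^r(\Phi)$ is the set of $C^r$ actions $\Psi:\mathbb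 R^d\times M\to M$ such that $\Phi_v\circ\Psi_u=\Psi_u\circ\Phi_v$ for all $u,v\in\mathbb R^d$. *)

theory Defs
  imports "HOL-Analysis.Analysis"
begin

(* The n-torus as the n-fold product of unit circles, an embedded submanifold of complex ^ 'n.
   Its distance is the restriction of the ambient Euclidean one; as the torus is compact,
   expansiveness does not depend on which distance inducing the topology is used. *)
definition torus :: "(complex ^ 'n) set" where
  "torus = {z. \<forall>i. norm (z $ i) = 1}"

definition C1_on_open :: "'a::euclidean_space set \<Rightarrow> ('a \<Rightarrow> 'b::euclidean_space) \<Rightarrow> bool" where
  "C1_on_open U f \<longleftrightarrow> open U \<and>
     (\<exists>f' :: 'a \<Rightarrow> 'a \<Rightarrow>\<^sub>L 'b.
        (\<forall>x\<in>U. (f has_derivative blinfun_apply (f' x)) (at x)) \<and> continuous_on U f')"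

(* C^1 maps on subsets of Euclidean space (in particular on embedded submanifolds): near each
   point the map is the restriction of a C^1 map defined on an ambient neighbourhood. *)
definition C1_map :: "'a::euclidean_space set \<Rightarrow> 'b::euclidean_space set \<Rightarrow> ('a \<Rightarrow> 'b) \<Rightarrow> bool" where
  "C1_map S T f \<longleftrightarrow> f ` S \<subseteq> T \<and>
     (\<forall>x\<in>S. \<exists>U F. x \<in> U \<and> C1_on_open U F \<and> (\<forall>y\<in>S \<inter> U. F y = f y))"

definition C1_diffeo :: "'a::euclidean_space set \<Rightarrow> 'b::euclidean_space set \<Rightarrow> ('a \<Rightarrow> 'b) \<Rightarrow> bool" where
  "C1_diffeo S T f \<longleftrightarrow> bij_betw f S T \<and> C1_map S T f \<and> C1_map T S (inv_into S f)"

(* Only the values of the action on UNIV \<times> M matter, here and in all later definitions. *)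
definition C1_action ::
  "'a::euclidean_space set \<Rightarrow> ((real ^ 'd) \<times> 'a \<Rightarrow> 'a) \<Rightarrow> bool" where
  "C1_action M \<Phi> \<longleftrightarrow>
     C1_map (UNIV \<times> M) M \<Phi> \<and>
     (\<forall>v. C1_diffeo M M (\<lambda>x. \<Phi> (v, x))) \<and>
     (\<forall>u v. \<forall>x\<in>M. \<Phi> (v + u, x) = \<Phi> (v, \<Phi> (u, x)))"

definition expansive ::
  "'a::euclidean_space set \<Rightarrow> ((real ^ 'd) \<times> 'a \<Rightarrow> 'a) \<Rightarrow> bool" where
  "expansive M \<Phi> \<longleftrightarrow>
     (\<forall>\<epsilon>>0. \<exists>\<delta>>0. \<forall>x\<in>M. \<forall>y\<in>M.
        (\<exists>h :: real ^ 'd \<Rightarrow> real ^ 'd.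
           continuous_on UNIV h \<and> h 0 = 0 \<and> (\<forall>v. dist (\<Phi> (v, x)) (\<Phi> (h v, y)) < \<delta>)) \<longrightarrow>
        (\<exists>v\<^sub>0. norm v\<^sub>0 < \<epsilon> \<and> y = \<Phi> (v\<^sub>0, x)))"

definition C1_immersion_on :: "'a::euclidean_space set \<Rightarrow> ('a \<Rightarrow> 'b::euclidean_space) \<Rightarrow> bool" where
  "C1_immersion_on U f \<longleftrightarrow> C1_on_open U f \<and> (\<forall>x\<in>U. inj (frechet_derivative f (at x)))"

(* S carries a manifold structure of dimension CARD('d), with some manifold topology X
   (possibly finer than the subspace topology), whose inclusion into M is a C^1 immersion.
   The structure is given by local parametrizations; that the transition maps are C^1 need not
   be required, since it follows from the parametrizations being immersions and homeomorphisms
   onto X-open sets. *)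
definition immersed_submanifold ::
  "'d::finite itself \<Rightarrow> 'a::euclidean_space set \<Rightarrow> 'a set \<Rightarrow> bool" where
  "immersed_submanifold _ M S \<longleftrightarrow> S \<subseteq> M \<and>
     (\<exists>X. topspace X = S \<and> Hausdorff_space X \<and> second_countable X \<and>
        (\<forall>p\<in>S. \<exists>W (U :: (real ^ 'd) set) \<phi>.
           openin X W \<and> p \<in> W \<and> C1_immersion_on U \<phi> \<and>
           homeomorphic_map (top_of_set U) (subtopology X W) \<phi>))"

definition orbit :: "((real ^ 'd) \<times> 'a \<Rightarrow> 'a) \<Rightarrow> 'a \<Rightarrow> 'a set" where
  "orbit \<Phi> x = range (\<lambda>v. \<Phi> (v, x))"

definition homogeneous ::
  "'a::euclidean_space set \<Rightarrow> ((real ^ 'd) \<times> 'a \<Rightarrow> 'a) \<Rightarrow> bool" where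
  "homogeneous M \<Phi> \<longleftrightarrow> (\<forall>x\<in>M. immersed_submanifold TYPE('d) M (orbit \<Phi> x))"

definition C1_centralizer ::
  "'a::euclidean_space set \<Rightarrow> ((real ^ 'd) \<times> 'a \<Rightarrow> 'a) \<Rightarrow> ((real ^ 'd) \<times> 'a \<Rightarrow> 'a) set" where
  "C1_centralizer M \<Phi> =
     {\<Psi>. C1_action M \<Psi> \<and> (\<forall>u v. \<forall>x\<in>M. \<Phi> (v, \<Psi> (u, x)) = \<Psi> (u, \<Phi> (v, x)))}"

definition quasi_trivial_C1_centralizer ::
  "'a::euclidean_space set \<Rightarrow> ((real ^ 'd) \<times> 'a \<Rightarrow> 'a) \<Rightarrow> bool" where
  "quasi_trivial_C1_centralizer M \<Phi> \<longleftrightarrow>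
     (\<forall>\<Psi>\<in>C1_centralizer M \<Phi>. \<exists>A :: 'a \<Rightarrow> real ^ 'd ^ 'd.
        C1_map M UNIV A \<and>
        (\<forall>v. \<forall>x\<in>M. A x = A (\<Phi> (v, x))) \<and>
        (\<forall>v. \<forall>x\<in>M. \<Psi> (v, x) = \<Phi> (A x *v v, x)))"

end

theory Submission
  imports Defs
begin

text \<open>Let \<open>\<Psi>\<close> commute with \<open>\<Phi>\<close>. For small \<open>u\<close> the map \<open>\<Psi>\<^sub>u\<close> is uniformly close to the identity on the
  compact torus, and since it commutes with \<open>\<Phi>\<close>, the points \<open>x\<close> and \<open>\<Psi>\<^sub>u(x)\<close> stay close along their
  whole \<open>\<Phi>\<close>-orbits. Expansiveness, with the identity as reparametrization, therefore yields
  \<open>\<Psi>\<^sub>u(x) = \<Phi>(\<alpha> u x, x)\<close> with \<open>\<alpha> u x\<close> small (\<open>centralizer_moves_along_orbits\<close>). What remains is to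
  see that \<open>\<alpha>\<close> is linear in \<open>u\<close>, invariant along orbits, and of class C1 in \<open>x\<close>; then
  \<open>\<alpha> u x = A(x) u\<close>.

  All of this rests on short times being determined by positions, that is, on \<open>\<Phi>\<close> being locally free
  in a uniform way. Homogeneity constrains the orbits only as sets. It makes the orbit maps
  \<open>v \<mapsto> \<Phi>(v, x)\<close> immersions because a degenerate orbit map factors through a hyperplane, and then its
  image is too small to contain an immersed piece of full dimension
  (\<open>orbit_map_derivative_inj\<close>). The inverse function theorem then provides, near every point, a C1
  function that computes \<open>v\<close> from \<open>\<Phi>(v, y)\<close> and \<open>y\<close> (\<open>local_time_function\<close>). It gives uniqueness of
  \<open>\<alpha>\<close>, with a radius that is uniform by compactness, and smoothness of \<open>\<alpha>\<close>.

  Uniqueness makes \<open>\<alpha>\<close> invariant along orbits and gives \<open>\<alpha> u x = 2 \<alpha> (u/2) x\<close>; being differentiable at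
  \<open>u = 0\<close>, it then coincides with its derivative (\<open>halving_eq_derivative\<close>).\<close>

section \<open>Calculus of C1 maps on open sets\<close>

lemma C1_on_openE:
  assumes "C1_on_open U f"
  obtains f' where "open U" "\<And>x. x \<in> U \<Longrightarrow> (f has_derivative blinfun_apply (f' x)) (at x)"
    "continuous_on U f'"
  using assms unfolding C1_on_open_def by blast

lemma C1_on_open_continuous: "C1_on_open U f \<Longrightarrow> continuous_on U f"
  by (metis C1_on_openE continuous_at_imp_continuous_on has_derivative_continuous)

lemma C1_on_open_const: "open U \<Longrightarrow> C1_on_open U (\<lambda>x. c)"
  unfolding C1_on_open_def by (intro conjI exI[of _ "\<lambda>x. 0"])
    (auto simp: zero_blinfun.rep_eq)

lemma C1_on_open_linear:
  fixes f :: "'a::euclidean_space \<Rightarrow> 'b::euclidean_space"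
  assumes "open U" "linear f"
  shows "C1_on_open U f"
  unfolding C1_on_open_def
proof (intro conjI exI[of _ "\<lambda>x. Blinfun f"] ballI)
  have "bounded_linear f"
    using assms(2) by (simp add: linear_conv_bounded_linear)
  then show "(f has_derivative blinfun_apply (Blinfun f)) (at x)" for x
    by (simp add: bounded_linear_Blinfun_apply bounded_linear_imp_has_derivative)
qed (use assms in auto)

lemma C1_on_open_add:
  assumes "C1_on_open U f" "C1_on_open U g"
  shows "C1_on_open U (\<lambda>x. f x + g x)"
proof -
  obtain f' where f': "open U" "\<And>x. x \<in> U \<Longrightarrow> (f has_derivative blinfun_apply (f' x)) (at x)"
    "continuous_on U f'"
    using C1_on_openE[OF assms(1)] by blast
  obtain g' where g': "\<And>x. x \<in> U \<Longrightarrow> (g has_derivative blinfun_apply (g' x)) (at x)"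
    "continuous_on U g'"
    using C1_on_openE[OF assms(2)] by blast
  show ?thesis
    unfolding C1_on_open_def
    using f' g' by (intro conjI exI[of _ "\<lambda>x. f' x + g' x"] ballI)
      (auto simp: plus_blinfun.rep_eq intro!: has_derivative_add continuous_on_add)
qed

lemma C1_on_open_sum:
  assumes "open U" "\<And>i. i \<in> I \<Longrightarrow> C1_on_open U (f i)"
  shows "C1_on_open U (\<lambda>x. \<Sum>i\<in>I. f i x)"
  using assms
proof (induction I rule: infinite_finite_induct)
  case (insert i I)
  then show ?case
    by (simp add: C1_on_open_add)
qed (auto intro: C1_on_open_const)

lemma C1_on_open_compose:
  assumes f: "C1_on_open U f" and g: "C1_on_open V g" and W: "open W" "W \<subseteq> U" "f ` W \<subseteq> V"
  shows "C1_on_open W (\<lambda>x. g (f x))"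
proof -
  obtain f' where f': "open U" "\<And>x. x \<in> U \<Longrightarrow> (f has_derivative blinfun_apply (f' x)) (at x)"
    "continuous_on U f'"
    using C1_on_openE[OF f] by blast
  obtain g' where g': "\<And>x. x \<in> V \<Longrightarrow> (g has_derivative blinfun_apply (g' x)) (at x)"
    "continuous_on V g'"
    using C1_on_openE[OF g] by blast
  have "continuous_on W f"
    using C1_on_open_continuous[OF f] W(2) continuous_on_subset by blast
  then have "continuous_on W (\<lambda>x. g' (f x))"
    using g'(2) W(3) continuous_on_compose2 by blast
  moreover have "continuous_on W f'"
    using f'(3) W(2) continuous_on_subset by blast
  ultimately have "continuous_on W (\<lambda>x. g' (f x) o\<^sub>L f' x)"
    by (intro continuous_intros)
  moreover have "((\<lambda>x. g (f x)) has_derivative blinfun_apply (g' (f x) o\<^sub>L f' x)) (at x)"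
    if "x \<in> W" for x
  proof -
    have "((\<lambda>x. g (f x)) has_derivative (\<lambda>h. g' (f x) (f' x h))) (at x)"
      using that W by (intro has_derivative_compose[OF f'(2) g'(1)]) auto
    then show ?thesis
      by (rule has_derivative_eq_rhs) (simp add: fun_eq_iff)
  qed
  ultimately show ?thesis
    unfolding C1_on_open_def using W(1)
    by (intro conjI exI[of _ "\<lambda>x. g' (f x) o\<^sub>L f' x"]) auto
qed

lemma C1_on_open_linear_compose:
  assumes "C1_on_open U f" "linear g"
  shows "C1_on_open U (\<lambda>x. g (f x))"
proof -
  have "open U"
    using assms(1) by (simp add: C1_on_open_def)
  then show ?thesis
    by (intro C1_on_open_compose[OF assms(1) C1_on_open_linear[OF open_UNIV assms(2)]]) auto
qed

lemma C1_on_open_Pair: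
  assumes "C1_on_open U f" "C1_on_open U g"
  shows "C1_on_open U (\<lambda>x. (f x, g x))"
proof -
  have "C1_on_open U (\<lambda>x. (f x, 0) + (0, g x))"
    by (intro C1_on_open_add C1_on_open_linear_compose[OF assms(1), of "\<lambda>z. (z, 0)"]
        C1_on_open_linear_compose[OF assms(2), of "\<lambda>z. (0, z)"])
      (auto intro!: linearI)
  then show ?thesis
    by simp
qed

text \<open>Inversion of operators is continuous by the resolvent identity
  \<open>B - B\<^sub>0 = B (A\<^sub>0 - A) B\<^sub>0\<close>: as soon as \<open>\<parallel>A - A\<^sub>0\<parallel> \<parallel>B\<^sub>0\<parallel> \<le> 1/2\<close>, it bounds
  \<open>\<parallel>B\<parallel>\<close> by \<open>2 \<parallel>B\<^sub>0\<parallel>\<close>, and then \<open>\<parallel>B - B\<^sub>0\<parallel>\<close> by a multiple of \<open>\<parallel>A - A\<^sub>0\<parallel>\<close>.\<close>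

lemma continuous_on_blinfun_inverse:
  fixes a b :: "'c::topological_space \<Rightarrow> ('a::real_normed_vector \<Rightarrow>\<^sub>L 'a)"
  assumes a: "continuous_on V a"
    and ba: "\<And>y. y \<in> V \<Longrightarrow> b y o\<^sub>L a y = id_blinfun"
    and ab: "\<And>y. y \<in> V \<Longrightarrow> a y o\<^sub>L b y = id_blinfun"
  shows "continuous_on V b"
  unfolding continuous_on_def
proof
  fix y0 assume y0: "y0 \<in> V"
  define K where "K = norm (b y0)"
  have lim: "((\<lambda>y. norm (a y - a y0)) \<longlongrightarrow> 0) (at y0 within V)"
    using a y0 unfolding continuous_on_def by (simp add: LIM_zero tendsto_norm_zero)
  then have "((\<lambda>y. norm (a y - a y0) * K) \<longlongrightarrow> 0 * K) (at y0 within V)"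
    by (intro tendsto_mult_right)
  then have ev: "\<forall>\<^sub>F y in at y0 within V. norm (a y - a y0) * K < 1/2"
    by (intro order_tendstoD) auto
  have bound: "norm (b y - b y0) \<le> 2 * K * K * norm (a y - a y0)"
    if y: "y \<in> V" and small: "norm (a y - a y0) * K < 1/2" for y
  proof -
    have "b y - b y0 = b y o\<^sub>L (a y0 - a y) o\<^sub>L b y0"
    proof (rule blinfun_eqI)
      fix w
      have "b y (a y z) = z" "a y0 (b y0 z) = z" for z
        using ba[OF y] ab[OF y0] by (metis blinfun_apply_blinfun_compose blinfun_apply_id_blinfun)+
      then show "(b y - b y0) w = (b y o\<^sub>L (a y0 - a y) o\<^sub>L b y0) w"
        by (simp add: blinfun.diff_left blinfun.diff_right)
    qed
    then have "norm (b y - b y0) \<le> norm (b y o\<^sub>L (a y0 - a y)) * K"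
      unfolding K_def by (metis norm_blinfun_compose)
    also have "\<dots> \<le> norm (b y) * norm (a y0 - a y) * K"
      by (intro mult_right_mono norm_blinfun_compose) (simp add: K_def)
    finally have le: "norm (b y - b y0) \<le> norm (b y) * (norm (a y - a y0) * K)"
      by (simp add: norm_minus_commute mult.assoc)
    also have "\<dots> \<le> norm (b y) * (1/2)"
      using small by (intro mult_left_mono) auto
    finally have "norm (b y) \<le> 2 * K"
      using norm_triangle_sub[of "b y" "b y0"] by (simp add: K_def)
    then have "norm (b y) * (norm (a y - a y0) * K) \<le> 2 * K * (norm (a y - a y0) * K)"
      by (intro mult_right_mono) (auto simp: K_def)
    with le show ?thesis
      by (simp add: mult_ac)
  qed
  have "((\<lambda>y. b y - b y0) \<longlongrightarrow> 0) (at y0 within V)"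
  proof (rule Lim_null_comparison)
    have eventually_at_in_V: "\<forall>\<^sub>F y in at y0 within V. y \<in> V"
      by (auto simp: eventually_at_filter)
    show "\<forall>\<^sub>F y in at y0 within V. norm (b y - b y0) \<le> 2 * K * K * norm (a y - a y0)"
      using eventually_at_in_V ev by (rule eventually_elim2) (rule bound)
    show "((\<lambda>y. 2 * K * K * norm (a y - a y0)) \<longlongrightarrow> 0) (at y0 within V)"
      using tendsto_mult_left[OF lim, of "2 * K * K"] by simp
  qed
  then show "(b \<longlongrightarrow> b y0) (at y0 within V)"
    by (rule LIM_zero_cancel)
qed

text \<open>The derivative of the local inverse consists of the inverses of the derivatives of \<open>f\<close>, so it is
  continuous by the continuity of operator inversion.\<close>

lemma C1_local_inverse:
  fixes f :: "'a::euclidean_space \<Rightarrow> 'a"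
  assumes f: "C1_on_open U f" "x0 \<in> U" and D: "(f has_derivative D) (at x0)" "inj D"
  obtains U' V g where "open U'" "x0 \<in> U'" "U' \<subseteq> U" "f ` U' = V" "C1_on_open V g"
    "\<forall>x\<in>U'. g (f x) = x"
proof -
  obtain f' where f': "open U" "\<And>x. x \<in> U \<Longrightarrow> (f has_derivative blinfun_apply (f' x)) (at x)"
    "continuous_on U f'"
    using C1_on_openE[OF f(1)] by blast
  have Df': "D = blinfun_apply (f' x0)"
    using D(1) f'(2)[OF f(2)] has_derivative_unique by blast
  have "linear D"
    using D(1) has_derivative_linear by blast
  then obtain P where P: "linear P" "P \<circ> D = id"
    using linear_injective_left_inverse[OF _ D(2)] by blast
  then have "Blinfun P o\<^sub>L f' x0 = id_blinfun"
    by (intro blinfun_eqI) (metis Df' blinfun_apply_blinfun_compose blinfun_apply_id_blinfun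
        bounded_linear_Blinfun_apply comp_apply id_apply linear_conv_bounded_linear)
  then obtain U' V g g' where *: "open U'" "U' \<subseteq> U" "x0 \<in> U'" "open V" "homeomorphism U' V f g"
    "\<And>y. y \<in> V \<Longrightarrow> (g has_derivative (g' y)) (at y)"
    "\<And>y. y \<in> V \<Longrightarrow> g' y = inv (blinfun_apply (f' (g y)))"
    "\<And>y. y \<in> V \<Longrightarrow> bij (blinfun_apply (f' (g y)))"
    using inverse_function_theorem[OF f'(1,2,3) f(2)] by metis
  have gV: "g ` V = U'" "continuous_on V g" "f ` U' = V" "\<forall>x\<in>U'. g (f x) = x"
    using *(5) unfolding homeomorphism_def by auto
  have app: "blinfun_apply (Blinfun (g' y)) = inv (blinfun_apply (f' (g y)))" if "y \<in> V" for y
    using *(6,7)[OF that] by (metis bounded_linear_Blinfun_apply has_derivative_bounded_linear)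
  have "continuous_on V (\<lambda>y. Blinfun (g' y))"
  proof (rule continuous_on_blinfun_inverse[where a = "\<lambda>y. f' (g y)"])
    show "continuous_on V (\<lambda>y. f' (g y))"
      using f'(3) gV(1,2) *(2) continuous_on_compose2 by blast
    show "Blinfun (g' y) o\<^sub>L f' (g y) = id_blinfun" if "y \<in> V" for y
      using *(8)[OF that] by (intro blinfun_eqI) (simp add: app[OF that] bij_is_inj)
    show "f' (g y) o\<^sub>L Blinfun (g' y) = id_blinfun" if "y \<in> V" for y
      using *(8)[OF that]
      by (intro blinfun_eqI) (simp add: app[OF that] bij_is_surj surj_f_inv_f)
  qed
  then have "C1_on_open V g"
    unfolding C1_on_open_def using *(4,6,7) app by (intro conjI exI[of _ "\<lambda>y. Blinfun (g' y)"]) auto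
  with * gV that show thesis
    by blast
qed

section \<open>Homogeneous actions are locally free\<close>

lemma C1_mapE:
  assumes "C1_map S T f" "x \<in> S"
  obtains U F where "C1_on_open U F" "x \<in> U" "\<forall>y\<in>S \<inter> U. F y = f y"
  using assms unfolding C1_map_def by blast

lemma C1_action_mem: "C1_action M \<Phi> \<Longrightarrow> x \<in> M \<Longrightarrow> \<Phi> (v, x) \<in> M"
  unfolding C1_action_def C1_map_def by blast

lemma C1_action_add:
  "C1_action M \<Phi> \<Longrightarrow> x \<in> M \<Longrightarrow> \<Phi> (v + u, x) = \<Phi> (v, \<Phi> (u, x))"
  unfolding C1_action_def by blast

lemma C1_action_zero:
  assumes "C1_action M \<Phi>" "x \<in> M"
  shows "\<Phi> (0, x) = x"
proof -
  have "inj_on (\<lambda>x. \<Phi> (0, x)) M"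
    using assms(1) by (simp add: C1_action_def C1_diffeo_def bij_betw_def)
  moreover have "\<Phi> (0, \<Phi> (0, x)) = \<Phi> (0, x)"
    using C1_action_add[OF assms, of 0 0] by simp
  ultimately show ?thesis
    using assms C1_action_mem by (metis inj_onD)
qed

lemma C1_action_extension:
  assumes "C1_action M \<Phi>" "x \<in> M"
  obtains U F where "C1_on_open U F" "(v, x) \<in> U" "\<And>u y. y \<in> M \<Longrightarrow> (u, y) \<in> U \<Longrightarrow> F (u, y) = \<Phi> (u, y)"
proof -
  have "C1_map (UNIV \<times> M) M \<Phi>" "(v, x) \<in> UNIV \<times> M"
    using assms by (auto simp: C1_action_def)
  then obtain U F where "C1_on_open U F" "(v, x) \<in> U"
    "\<forall>z\<in>(UNIV \<times> M) \<inter> U. F z = \<Phi> z"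
    by (rule C1_mapE)
  then show thesis
    using that[of U F] by simp
qed

lemma orbit_map_differentiable:
  assumes "C1_action M \<Phi>" "x \<in> M"
  shows "(\<lambda>u. \<Phi> (u, x)) differentiable (at v)"
proof -
  obtain U F where U: "C1_on_open U F" "(v, x) \<in> U"
    "\<And>u y. y \<in> M \<Longrightarrow> (u, y) \<in> U \<Longrightarrow> F (u, y) = \<Phi> (u, y)"
    using C1_action_extension[OF assms] by metis
  obtain F' where F': "open U" "\<And>z. z \<in> U \<Longrightarrow> (F has_derivative blinfun_apply (F' z)) (at z)"
    using C1_on_openE[OF U(1)] by metis
  have "((\<lambda>u. (u, x)) has_derivative (\<lambda>h. (h, 0))) (at v)"
    by (auto intro!: derivative_eq_intros)
  then have "((\<lambda>u. F (u, x)) has_derivative (\<lambda>h. F' (v, x) (h, 0))) (at v)"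
    using has_derivative_compose F'(2) U(2) by blast
  moreover have "open ((\<lambda>u. (u, x)) -` U)"
    using F'(1) by (intro open_vimage continuous_intros)
  ultimately have "((\<lambda>u. \<Phi> (u, x)) has_derivative (\<lambda>h. F' (v, x) (h, 0))) (at v)"
    by (rule has_derivative_transform_within_open) (use U assms in auto)
  then show ?thesis
    by (auto simp: differentiable_def)
qed

text \<open>The velocity of the orbit at time \<open>t\<close> is the image under the derivative of the time-\<open>t\<close>
  map of the velocity at time 0. Hence an orbit that starts with velocity zero never moves.\<close>

lemma stationary_if_initial_velocity_zero:
  assumes \<Phi>: "C1_action M \<Phi>" and x: "x \<in> M"
    and 0: "((\<lambda>s. \<Phi> (s *\<^sub>R w, x)) has_derivative (\<lambda>h. 0)) (at (0::real))"
  shows "\<Phi> (t *\<^sub>R w, x) = x"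
proof -
  define c where "c s = \<Phi> (s *\<^sub>R w, x)" for s :: real
  have c0: "c 0 = x"
    using C1_action_zero[OF \<Phi> x] by (simp add: c_def)
  have "(c has_derivative (\<lambda>h. 0)) (at t)" for t
  proof -
    obtain U F where U: "C1_on_open U F" "(t *\<^sub>R w, x) \<in> U"
      "\<And>u y. y \<in> M \<Longrightarrow> (u, y) \<in> U \<Longrightarrow> F (u, y) = \<Phi> (u, y)"
      using C1_action_extension[OF \<Phi> x] by metis
    obtain F' where F': "open U" "\<And>z. z \<in> U \<Longrightarrow> (F has_derivative blinfun_apply (F' z)) (at z)"
      using C1_on_openE[OF U(1)] by metis
    have dc: "(c has_derivative (\<lambda>h. 0)) (at 0)"
      using 0 by (simp add: c_def[abs_def])
    then have dp: "((\<lambda>s. (t *\<^sub>R w, c s)) has_derivative (\<lambda>h. (0, 0))) (at 0)"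
      by (intro has_derivative_Pair has_derivative_const)
    then have "((\<lambda>s. F (t *\<^sub>R w, c s)) has_derivative (\<lambda>h. F' (t *\<^sub>R w, x) (0, 0))) (at 0)"
      using F'(2)[OF U(2)] by (intro has_derivative_compose[OF dp]) (simp add: c0)
    moreover have "F' (t *\<^sub>R w, x) (0, 0) = 0"
      by (metis blinfun.zero_right zero_prod_def)
    ultimately have dF: "((\<lambda>s. F (t *\<^sub>R w, c s)) has_derivative (\<lambda>h. 0)) (at 0)"
      by simp
    have "isCont (\<lambda>s. (t *\<^sub>R w, c s)) 0"
      using dp has_derivative_continuous by blast
    then have "\<forall>\<^sub>F s in at 0. (t *\<^sub>R w, c s) \<in> U"
      using F'(1) U(2) c0
      by (intro topological_tendstoD[of _ "(t *\<^sub>R w, c 0)"]) (auto simp: isCont_def)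
    then have ev: "\<forall>\<^sub>F s in at 0. F (t *\<^sub>R w, c s) = c (s + t)"
    proof (rule eventually_mono)
      fix s assume "(t *\<^sub>R w, c s) \<in> U"
      then show "F (t *\<^sub>R w, c s) = c (s + t)"
        using U(3) C1_action_mem[OF \<Phi> x] C1_action_add[OF \<Phi> x, of "t *\<^sub>R w" "s *\<^sub>R w"]
        by (simp add: c_def scaleR_add_left add.commute)
    qed
    have "F (t *\<^sub>R w, c 0) = c (0 + t)"
      using U(2,3) x c0 by (simp add: c_def)
    then have "((\<lambda>s. c (s + t)) has_derivative (\<lambda>h. 0)) (at 0)"
      using has_derivative_transform_eventually[OF dF ev] by simp
    moreover have "((\<lambda>s. s - t) has_derivative (\<lambda>h. h)) (at t)"
      by (auto intro!: derivative_eq_intros)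
    ultimately have "((\<lambda>s. c (s - t + t)) has_derivative (\<lambda>h. 0)) (at t)"
      using has_derivative_compose[of "\<lambda>s. s - t" "\<lambda>h. h" t UNIV "\<lambda>s. c (s + t)" "\<lambda>h. 0"] by simp
    then show ?thesis
      by simp
  qed
  then have "c t = c 0"
    using has_derivative_zero_unique[of UNIV c t 0] by auto
  then show ?thesis
    using c0 by (simp add: c_def)
qed

text \<open>If the derivative killed a direction \<open>w\<close>, the orbit map would be constant along \<open>w\<close>, and the
  orbit would be the image of the hyperplane orthogonal to \<open>w\<close>. Project by a left inverse \<open>P\<close> of
  the derivative of a chart \<open>\<phi>\<close> of the orbit: the image of the hyperplane becomes negligible, whereas
  \<open>P \<circ> \<phi>\<close> has an open image near a point where its derivative is the identity.\<close>

lemma orbit_map_derivative_inj: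
  fixes \<Phi> :: "(real ^ 'd) \<times> 'a::euclidean_space \<Rightarrow> 'a"
  assumes \<Phi>: "C1_action M \<Phi>" and x: "x \<in> M"
    and S: "immersed_submanifold TYPE('d) M (orbit \<Phi> x)"
    and D: "((\<lambda>v. \<Phi> (v, x)) has_derivative D) (at 0)"
  shows "inj D"
proof (rule ccontr)
  assume "\<not> inj D"
  moreover have linD: "linear D"
    using D has_derivative_linear by blast
  ultimately obtain w where w: "D w = 0" "w \<noteq> 0"
    using linear_injective_0 by blast
  have dw: "((\<lambda>s::real. s *\<^sub>R w) has_derivative (\<lambda>h. h *\<^sub>R w)) (at 0)"
    by (auto intro!: derivative_eq_intros)
  have "((\<lambda>s::real. \<Phi> (s *\<^sub>R w, x)) has_derivative (\<lambda>h. D (h *\<^sub>R w))) (at 0)"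
    using has_derivative_compose[OF dw, of "\<lambda>v. \<Phi> (v, x)" D] D by simp
  then have "((\<lambda>s::real. \<Phi> (s *\<^sub>R w, x)) has_derivative (\<lambda>h. 0)) (at 0)"
    by (simp add: linear_cmul[OF linD] w(1))
  then have stat: "\<Phi> (t *\<^sub>R w, x) = x" for t
    using stationary_if_initial_velocity_zero[OF \<Phi> x] by blast
  define H where "H = {v. w \<bullet> v = 0}"
  have orbit: "orbit \<Phi> x \<subseteq> (\<lambda>v. \<Phi> (v, x)) ` H"
  proof
    fix z assume "z \<in> orbit \<Phi> x"
    then obtain v where v: "z = \<Phi> (v, x)"
      by (auto simp: orbit_def)
    define t where "t = (w \<bullet> v) / (w \<bullet> w)"
    have "z = \<Phi> (v - t *\<^sub>R w, x)"
      using C1_action_add[OF \<Phi> x, of "v - t *\<^sub>R w" "t *\<^sub>R w"] stat v by simp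
    moreover have "v - t *\<^sub>R w \<in> H"
      using w(2) by (simp add: H_def t_def inner_diff_right)
    ultimately show "z \<in> (\<lambda>v. \<Phi> (v, x)) ` H"
      by blast
  qed
  have x_orbit: "x \<in> orbit \<Phi> x"
    unfolding orbit_def using C1_action_zero[OF \<Phi> x] by (metis rangeI)
  obtain X where X: "topspace X = orbit \<Phi> x"
    "\<forall>p\<in>orbit \<Phi> x. \<exists>W (U :: (real ^ 'd) set) \<phi>. openin X W \<and> p \<in> W \<and> C1_immersion_on U \<phi> \<and>
       homeomorphic_map (top_of_set U) (subtopology X W) \<phi>"
    using S unfolding immersed_submanifold_def by blast
  then obtain W and U :: "(real ^ 'd) set" and \<phi> where \<phi>: "x \<in> W" "C1_immersion_on U \<phi>"
    "homeomorphic_map (top_of_set U) (subtopology X W) \<phi>"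
    using x_orbit by blast
  have \<phi>U: "\<phi> ` U = orbit \<Phi> x \<inter> W"
    using homeomorphic_imp_surjective_map[OF \<phi>(3)] X(1) by simp
  then obtain p where p: "p \<in> U"
    using x_orbit \<phi>(1) by blast
  define E where "E = frechet_derivative \<phi> (at p)"
  have C1: "C1_on_open U \<phi>" and injE: "inj E"
    using \<phi>(2) p by (auto simp: C1_immersion_on_def E_def)
  have dE: "(\<phi> has_derivative E) (at p)"
    using C1 p frechet_derivative_works differentiable_def unfolding E_def C1_on_open_def by blast
  then obtain P where P: "linear P" "P \<circ> E = id"
    using linear_injective_left_inverse[OF _ injE] has_derivative_linear by blast
  have bP: "bounded_linear P"
    using P(1) linear_conv_bounded_linear by blast
  have "((\<lambda>u. P (\<phi> u)) has_derivative (\<lambda>h. P (E h))) (at p)"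
    using bounded_linear.has_derivative[OF bP dE] .
  moreover have "(\<lambda>h. P (E h)) \<circ> id = id"
    using P(2) by (simp add: fun_eq_iff)
  moreover have "continuous_on U (\<lambda>u. P (\<phi> u))"
    using C1_on_open_continuous[OF C1_on_open_linear_compose[OF C1 P(1)]] .
  moreover have "open U"
    using C1 by (simp add: C1_on_open_def)
  ultimately have "P (\<phi> p) \<in> interior ((\<lambda>u. P (\<phi> u)) ` U)"
    using sussmann_open_mapping[of U "\<lambda>u. P (\<phi> u)" p "\<lambda>h. P (E h)" id U] p
    by (simp add: interior_open id_def)
  then have "\<not> negligible ((\<lambda>u. P (\<phi> u)) ` U)"
    using negligible_subset[OF _ interior_subset] open_not_negligible[OF open_interior] by blast
  moreover have "(\<lambda>u. P (\<phi> u)) ` U \<subseteq> (\<lambda>v. P (\<Phi> (v, x))) ` H"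
  proof -
    have "P ` \<phi> ` U \<subseteq> P ` (\<lambda>v. \<Phi> (v, x)) ` H"
      using \<phi>U orbit by (intro image_mono) blast
    then show ?thesis
      by (simp add: image_image)
  qed
  moreover have "negligible ((\<lambda>v. P (\<Phi> (v, x))) ` H)"
  proof (rule negligible_differentiable_image_negligible)
    show "negligible H"
      unfolding H_def using w(2) by (intro negligible_hyperplane) auto
    show "(\<lambda>v. P (\<Phi> (v, x))) differentiable_on H"
      unfolding differentiable_on_def
    proof
      fix v
      obtain D where "((\<lambda>u. \<Phi> (u, x)) has_derivative D) (at v)"
        using orbit_map_differentiable[OF \<Phi> x] differentiable_def by blast
      then show "(\<lambda>v. P (\<Phi> (v, x))) differentiable (at v within H)"
        using bounded_linear.has_derivative[OF bP] has_derivative_at_withinI differentiable_def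
        by blast
    qed
  qed simp
  ultimately show False
    using negligible_subset by blast
qed

section \<open>Reading off time from position\<close>

lemma open_contains_box:
  fixes U :: "('a::real_normed_vector \<times> 'b::real_normed_vector) set"
  assumes "open U" "(a, b) \<in> U"
  shows "\<exists>r>0. \<forall>v y. dist v a < r \<longrightarrow> dist y b < r \<longrightarrow> (v, y) \<in> U"
proof -
  obtain e where e: "e > 0" "ball (a, b) e \<subseteq> U"
    using assms openE by blast
  have "(v, y) \<in> U" if *: "dist v a < e / 2" "dist y b < e / 2" for v y
  proof -
    have "dist (v, y) (a, b) \<le> dist v a + dist y b"
      unfolding dist_Pair_Pair by (rule sqrt_sum_squares_le_sum) auto
    with * show ?thesis
      using e(2) by (auto simp: dist_commute subset_iff)
  qed
  then show ?thesis
    using e(1) half_gt_zero by blast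
qed

text \<open>Choose a linear \<open>P\<close> inverting the derivative of the orbit map from the left. The map
  \<open>(v, y) \<mapsto> (P (\<Phi> (v, y)), y)\<close> then has an invertible derivative at \<open>(0, x0)\<close>, and the first
  component of its local inverse recovers the time \<open>v\<close> from the two positions \<open>\<Phi> (v, y)\<close> and
  \<open>y\<close>. In particular short times are determined by the positions, uniformly near \<open>x0\<close>.\<close>

lemma local_time_function:
  fixes \<Phi> :: "(real ^ 'd) \<times> 'a::euclidean_space \<Rightarrow> 'a"
  assumes \<Phi>: "C1_action M \<Phi>" and x0: "x0 \<in> M"
    and D: "\<And>D. ((\<lambda>v. \<Phi> (v, x0)) has_derivative D) (at 0) \<Longrightarrow> inj D"
  obtains r V \<tau> where "r > 0" "C1_on_open V \<tau>" "(x0, x0) \<in> V"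
    "\<And>v y. y \<in> M \<Longrightarrow> norm v < r \<Longrightarrow> dist y x0 < r \<Longrightarrow> \<tau> (\<Phi> (v, y), y) = v"
proof -
  obtain U F where U: "C1_on_open U F" "(0, x0) \<in> U"
    "\<And>u y. y \<in> M \<Longrightarrow> (u, y) \<in> U \<Longrightarrow> F (u, y) = \<Phi> (u, y)"
    using C1_action_extension[OF \<Phi> x0] by metis
  obtain F' where F': "open U" "\<And>z. z \<in> U \<Longrightarrow> (F has_derivative blinfun_apply (F' z)) (at z)"
    using C1_on_openE[OF U(1)] by metis
  define E where "E = (\<lambda>h. F' (0, x0) (h, 0))"
  have "((\<lambda>u. (u, x0)) has_derivative (\<lambda>h. (h, 0))) (at 0)"
    by (auto intro!: derivative_eq_intros)
  then have "((\<lambda>u. F (u, x0)) has_derivative E) (at 0)"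
    unfolding E_def using has_derivative_compose F'(2) U(2) by blast
  moreover have "open ((\<lambda>u. (u, x0)) -` U)"
    using F'(1) by (intro open_vimage continuous_intros)
  ultimately have dE: "((\<lambda>u. \<Phi> (u, x0)) has_derivative E) (at 0)"
    by (rule has_derivative_transform_within_open) (use U x0 in auto)
  then obtain P where P: "linear P" "P \<circ> E = id"
    using linear_injective_left_inverse[OF _ D] has_derivative_linear by blast
  have PE: "P (F' (0, x0) (h, 0)) = h" for h
    using P(2) by (metis E_def comp_apply id_apply)
  define H where "H z = (P (F z), snd z)" for z
  have C1H: "C1_on_open U H"
    unfolding H_def
    by (intro C1_on_open_Pair C1_on_open_linear_compose[OF U(1) P(1)] C1_on_open_linear F'(1)
        linear_snd)
  have bP: "bounded_linear P"
    using P(1) linear_conv_bounded_linear by blast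
  have dH: "(H has_derivative (\<lambda>h. (P (F' (0, x0) h), snd h))) (at (0, x0))"
    unfolding H_def
    by (intro has_derivative_Pair bounded_linear.has_derivative[OF bP] F'(2) U(2)
        has_derivative_snd has_derivative_ident)
  have injH: "inj (\<lambda>h. (P (F' (0, x0) h), snd h))"
  proof (rule injI)
    fix h k assume eq: "(P (F' (0, x0) h), snd h) = (P (F' (0, x0) k), snd k)"
    then have "h - k = (fst h - fst k, 0)"
      by (simp add: prod_eq_iff)
    moreover have "P (F' (0, x0) (h - k)) = 0"
      using eq by (simp add: blinfun.diff_right linear_diff[OF P(1)])
    ultimately have "fst h = fst k"
      using PE by (metis eq_iff_diff_eq_0)
    with eq show "h = k"
      by (simp add: prod_eq_iff)
  qed
  obtain U' W g where W: "open U'" "(0, x0) \<in> U'" "U' \<subseteq> U" "H ` U' = W" "C1_on_open W g"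
    "\<forall>z\<in>U'. g (H z) = z"
    by (rule C1_local_inverse[OF C1H U(2) dH injH])
  define Q where "Q = (\<lambda>z::'a \<times> 'a. (P (fst z), snd z))"
  have linQ: "linear Q"
    unfolding Q_def by (intro linearI) (auto simp: linear_add[OF P(1)] linear_cmul[OF P(1)])
  have "open W"
    using W(5) by (simp add: C1_on_open_def)
  then have openV: "open (Q -` W)"
    by (intro open_vimage linear_continuous_on) (simp_all add: linQ linear_linear)
  have Q\<Phi>: "Q (\<Phi> z, snd z) = H z" if "z \<in> U" "snd z \<in> M" for z
    using U(3)[of "snd z" "fst z"] that by (simp add: Q_def H_def)
  obtain r where r: "r > 0" "\<And>v y. dist v 0 < r \<Longrightarrow> dist y x0 < r \<Longrightarrow> (v, y) \<in> U'"
    using open_contains_box[OF W(1,2)] by blast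
  show thesis
  proof
    show "r > 0" by fact
    show "C1_on_open (Q -` W) (\<lambda>z. fst (g (Q z)))"
      using C1_on_open_linear_compose[OF C1_on_open_compose
          [OF C1_on_open_linear[OF openV linQ] W(5) openV subset_refl] linear_fst] by auto
    show "(x0, x0) \<in> Q -` W"
      using Q\<Phi>[of "(0, x0)"] C1_action_zero[OF \<Phi> x0] U(2) x0 W(2,4) by auto
    fix v :: "real ^ 'd" and y assume "y \<in> M" "norm v < r" "dist y x0 < r"
    then show "fst (g (Q (\<Phi> (v, y), y))) = v"
      using Q\<Phi>[of "(v, y)"] r(2)[of v y] W(3,6) by auto
  qed
qed

section \<open>Uniform estimates on compact spaces\<close>

lemma compact_uniform_radius:
  fixes M :: "'a::metric_space set" and Q :: "'b::real_normed_vector \<Rightarrow> 'a \<Rightarrow> bool"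
  assumes "compact M"
    and "\<And>x. x \<in> M \<Longrightarrow> \<exists>r>0. \<forall>y\<in>M. \<forall>v. dist y x < r \<longrightarrow> norm v < r \<longrightarrow> Q v y"
  shows "\<exists>r>0. \<forall>y\<in>M. \<forall>v. norm v < r \<longrightarrow> Q v y"
proof -
  obtain R where R: "\<And>x. x \<in> M \<Longrightarrow> R x > 0"
    "\<And>x y v. x \<in> M \<Longrightarrow> y \<in> M \<Longrightarrow> dist y x < R x \<Longrightarrow> norm v < R x \<Longrightarrow> Q v y"
    using assms(2) by metis
  have "M \<subseteq> (\<Union>x\<in>M. ball x (R x))"
    using R(1) by (auto intro!: bexI)
  then obtain C where C: "C \<subseteq> M" "finite C" "M \<subseteq> (\<Union>x\<in>C. ball x (R x))"
    using compactE_image[OF assms(1), of M "\<lambda>x. ball x (R x)"] by auto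
  have "Q v y" if "norm v < Min (insert 1 (R ` C))" "y \<in> M" for v y
  proof -
    obtain x where "x \<in> C" "dist y x < R x"
      using C(3) \<open>y \<in> M\<close> by (auto simp: dist_commute)
    then show ?thesis
      using R(2)[of x y v] C that by auto
  qed
  moreover have "Min (insert 1 (R ` C)) > 0"
    using C R(1) by auto
  ultimately show ?thesis
    by blast
qed

lemma uniformly_locally_free:
  fixes \<Phi> :: "(real ^ 'd) \<times> 'a::euclidean_space \<Rightarrow> 'a"
  assumes "compact M" and \<Phi>: "C1_action M \<Phi>"
    and D: "\<And>x D. x \<in> M \<Longrightarrow> ((\<lambda>v. \<Phi> (v, x)) has_derivative D) (at 0) \<Longrightarrow> inj D"
  shows "\<exists>r>0. \<forall>x\<in>M. \<forall>v. norm v < r \<longrightarrow> \<Phi> (v, x) = x \<longrightarrow> v = 0"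
proof (rule compact_uniform_radius[OF assms(1)])
  fix x assume x: "x \<in> M"
  obtain r and \<tau> :: "'a \<times> 'a \<Rightarrow> real ^ 'd" where r: "r > 0"
    "\<And>v y. y \<in> M \<Longrightarrow> norm v < r \<Longrightarrow> dist y x < r \<Longrightarrow> \<tau> (\<Phi> (v, y), y) = v"
    using local_time_function[OF \<Phi> x D[OF x]] by metis
  have "v = 0" if "y \<in> M" "norm v < r" "dist y x < r" "\<Phi> (v, y) = y" for v y
    using r(2)[of y v] r(2)[of y 0] that r(1) C1_action_zero[OF \<Phi> \<open>y \<in> M\<close>] by simp
  then show "\<exists>r>0. \<forall>y\<in>M. \<forall>v. dist y x < r \<longrightarrow> norm v < r \<longrightarrow> \<Phi> (v, y) = y \<longrightarrow> v = 0"
    using r(1) by blast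
qed

lemma uniformly_small_displacement:
  fixes \<Psi> :: "(real ^ 'd) \<times> 'a::euclidean_space \<Rightarrow> 'a"
  assumes "compact M" and \<Psi>: "C1_action M \<Psi>" and "\<delta> > 0"
  shows "\<exists>\<rho>>0. \<forall>x\<in>M. \<forall>u. norm u < \<rho> \<longrightarrow> dist x (\<Psi> (u, x)) < \<delta>"
proof (rule compact_uniform_radius[OF assms(1)])
  fix x assume x: "x \<in> M"
  obtain U G where U: "C1_on_open U G" "(0, x) \<in> U"
    "\<And>u y. y \<in> M \<Longrightarrow> (u, y) \<in> U \<Longrightarrow> G (u, y) = \<Psi> (u, y)"
    using C1_action_extension[OF \<Psi> x] by metis
  have "open U"
    using U(1) by (simp add: C1_on_open_def)
  moreover have "continuous_on U (\<lambda>z. dist (snd z) (G z))"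
    using C1_on_open_continuous[OF U(1)] by (intro continuous_intros)
  ultimately have W: "open ((\<lambda>z. dist (snd z) (G z)) -` {..<\<delta>} \<inter> U)" (is "open ?W")
    by (metis continuous_on_open_vimage open_lessThan)
  have "(0, x) \<in> ?W"
    using U(2,3) x C1_action_zero[OF \<Psi> x] assms(3) by simp
  then obtain r where r: "r > 0" "\<forall>u y. dist u 0 < r \<longrightarrow> dist y x < r \<longrightarrow> (u, y) \<in> ?W"
    using open_contains_box[OF W] by blast
  have "dist y (\<Psi> (u, y)) < \<delta>" if "y \<in> M" "dist y x < r" "norm u < r" for u y
    using r(2)[rule_format, of u y] U(3)[of y u] that by auto
  then show "\<exists>r>0. \<forall>y\<in>M. \<forall>u. dist y x < r \<longrightarrow> norm u < r \<longrightarrow> dist y (\<Psi> (u, y)) < \<delta>"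
    using r(1) by blast
qed

section \<open>Functions that double with their argument\<close>

lemma halving_iterate:
  fixes f :: "'a::real_normed_vector \<Rightarrow> 'b::real_vector"
  assumes half: "\<And>u. norm u < \<rho> \<Longrightarrow> f u = 2 *\<^sub>R f ((1/2) *\<^sub>R u)" and u: "norm u < \<rho>"
  shows "f u = 2 ^ k *\<^sub>R f ((1/2) ^ k *\<^sub>R u)"
proof (induction k)
  case (Suc k)
  have "norm ((1/2) ^ k *\<^sub>R u) \<le> 1 * norm u"
    unfolding norm_scaleR by (intro mult_right_mono) (auto simp: power_le_one)
  with u have "norm ((1/2) ^ k *\<^sub>R u) < \<rho>"
    by simp
  from half[OF this] Suc show ?case
    by simp
qed simp

text \<open>The relative error \<open>\<parallel>f h - D h\<parallel> / \<parallel>h\<parallel>\<close> takes the same value at all \<open>h = u / 2\<^sup>k\<close>, and it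
  tends to 0 with \<open>h\<close>; so it is 0 at \<open>h = u\<close>.\<close>

lemma halving_eq_derivative:
  fixes f :: "'a::real_normed_vector \<Rightarrow> 'b::real_normed_vector"
  assumes half: "\<And>u. norm u < \<rho> \<Longrightarrow> f u = 2 *\<^sub>R f ((1/2) *\<^sub>R u)"
    and D: "(f has_derivative D) (at 0)" and u: "norm u < \<rho>"
  shows "f u = D u"
proof -
  have "\<rho> > 0"
    using u norm_ge_zero[of u] by linarith
  then have "f 0 = 2 *\<^sub>R f ((1/2) *\<^sub>R 0)"
    by (intro half) simp
  then have "f 0 + f 0 = f 0"
    by (metis scaleR_2 scaleR_zero_right)
  then have f0: "f 0 = 0"
    by simp
  have linD: "linear D"
    using D has_derivative_linear by blast
  show ?thesis
  proof (cases "u = 0")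
    case True
    then show ?thesis
      using f0 linear_0[OF linD] by simp
  next
    case False
    define h where "h k = (1/2::real) ^ k *\<^sub>R u" for k :: nat
    have "h \<longlonglongrightarrow> 0 *\<^sub>R u"
      unfolding h_def by (intro tendsto_intros LIMSEQ_realpow_zero) auto
    then have h: "filterlim h (at 0) sequentially"
      using False by (intro filterlim_atI) (auto simp: h_def)
    have "((\<lambda>y. norm (f y - D y) / norm y) \<longlongrightarrow> 0) (at 0)"
      using D f0 by (simp add: has_derivative_at)
    then have "(\<lambda>k. norm (f (h k) - D (h k)) / norm (h k)) \<longlonglongrightarrow> 0"
      using h by (rule filterlim_compose)
    moreover have "norm (f (h k) - D (h k)) / norm (h k) = norm (f u - D u) / norm u" for k
    proof -
      have "f u - D u = 2 ^ k *\<^sub>R (f (h k) - D (h k))"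
        using halving_iterate[where f = f, OF half u, of k]
        by (simp add: h_def linear_cmul[OF linD] scaleR_diff_right power_one_over)
      then have "norm (f u - D u) = 2 ^ k * norm (f (h k) - D (h k))"
        by simp
      moreover have "norm u = 2 ^ k * norm (h k)"
        by (simp add: h_def power_one_over)
      ultimately show ?thesis
        by simp
    qed
    ultimately have "norm (f u - D u) / norm u = 0"
      using LIMSEQ_unique[OF _ tendsto_const] by force
    with False show ?thesis
      by simp
  qed
qed

section \<open>The centralizer of an expansive locally free action\<close>

lemma C1_centralizerD:
  assumes "\<Psi> \<in> C1_centralizer M \<Phi>"
  shows "C1_action M \<Psi>" "x \<in> M \<Longrightarrow> \<Psi> (u, \<Phi> (v, x)) = \<Phi> (v, \<Psi> (u, x))"
  using assms unfolding C1_centralizer_def by auto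

text \<open>For small \<open>u\<close>, commutation turns the small displacement of \<open>\<Psi>\<^sub>u\<close> at \<open>\<Phi>\<^sub>v(x)\<close> into a small
  distance between \<open>\<Phi>\<^sub>v(x)\<close> and \<open>\<Phi>\<^sub>v(\<Psi>\<^sub>u(x))\<close>, for all \<open>v\<close> at once. So \<open>x\<close> and \<open>\<Psi>\<^sub>u(x)\<close>
  shadow each other without any reparametrization.\<close>

lemma centralizer_moves_along_orbits:
  fixes \<Phi> \<Psi> :: "(real ^ 'd) \<times> 'a::euclidean_space \<Rightarrow> 'a"
  assumes "compact M" "C1_action M \<Phi>" "expansive M \<Phi>" "\<Psi> \<in> C1_centralizer M \<Phi>" "\<epsilon> > 0"
  shows "\<exists>\<rho>>0. \<forall>x\<in>M. \<forall>u. norm u < \<rho> \<longrightarrow> (\<exists>v. norm v < \<epsilon> \<and> \<Psi> (u, x) = \<Phi> (v, x))"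
proof -
  note \<Psi> = C1_centralizerD[OF assms(4)]
  obtain \<delta> where \<delta>: "\<delta> > 0" "\<And>x y. x \<in> M \<Longrightarrow> y \<in> M \<Longrightarrow>
      \<exists>h :: real ^ 'd \<Rightarrow> real ^ 'd. continuous_on UNIV h \<and> h 0 = 0 \<and>
        (\<forall>v. dist (\<Phi> (v, x)) (\<Phi> (h v, y)) < \<delta>) \<Longrightarrow>
      \<exists>v. norm v < \<epsilon> \<and> y = \<Phi> (v, x)"
    using assms(3,5) unfolding expansive_def by meson
  obtain \<rho> where \<rho>: "\<rho> > 0"
    "\<And>u x. x \<in> M \<Longrightarrow> norm u < \<rho> \<Longrightarrow> dist x (\<Psi> (u, x)) < \<delta>"
    using uniformly_small_displacement[OF assms(1) \<Psi>(1) \<delta>(1)] by blast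
  have "\<exists>v. norm v < \<epsilon> \<and> \<Psi> (u, x) = \<Phi> (v, x)" if x: "x \<in> M" and u: "norm u < \<rho>" for x u
  proof (rule \<delta>(2)[OF x C1_action_mem[OF \<Psi>(1) x]], intro exI[of _ "\<lambda>v. v"] conjI allI)
    fix v
    have "dist (\<Phi> (v, x)) (\<Psi> (u, \<Phi> (v, x))) < \<delta>"
      using \<rho>(2)[OF C1_action_mem[OF assms(2) x] u] .
    then show "dist (\<Phi> (v, x)) (\<Phi> (v, \<Psi> (u, x))) < \<delta>"
      using \<Psi>(2)[OF x] by simp
  qed (auto intro: continuous_intros)
  with \<rho>(1) show ?thesis
    by blast
qed

text \<open>For small \<open>u\<close> let \<open>\<alpha> u x\<close> be the short time with \<open>\<Psi>\<^sub>u(x) = \<Phi>(\<alpha> u x, x)\<close>; local freeness makes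
  it unique. Uniqueness turns \<open>\<Psi>\<^sub>u = \<Psi>\<^sub>u\<^sub>/\<^sub>2 \<circ> \<Psi>\<^sub>u\<^sub>/\<^sub>2\<close> into \<open>\<alpha> u x = 2 \<alpha> (u/2) x\<close>, and commutation into
  the invariance of \<open>\<alpha> u\<close> along orbits. By halving, \<open>\<alpha> u x\<close> tends to 0 with \<open>u\<close>, uniformly in \<open>x\<close>,
  so near any point of \<open>M\<close> it is given, for small \<open>u\<close>, by a local time function applied to
  \<open>(\<Psi>\<^sub>u(x), x)\<close>, and hence is of class C1 in \<open>(u, x)\<close>. Differentiability at \<open>u = 0\<close> and halving
  force \<open>\<alpha> u x\<close> to be linear in \<open>u\<close>; this linear map is \<open>A(x)\<close>, and its columns are multiples of the
  values of \<open>\<alpha>\<close> at short multiples of the basis vectors. Doubling \<open>v\<close> extends \<open>\<Psi>\<^sub>v(x) = \<Phi>(A(x)v, x)\<close> from small \<open>v\<close> to all \<open>v\<close>.\<close>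

proposition expansive_locally_free_quasi_trivial_centralizer:
  fixes \<Phi> :: "(real ^ 'd) \<times> 'a::euclidean_space \<Rightarrow> 'a"
  assumes M: "compact M" and \<Phi>: "C1_action M \<Phi>" and exp: "expansive M \<Phi>"
    and free: "\<And>x D. x \<in> M \<Longrightarrow> ((\<lambda>v. \<Phi> (v, x)) has_derivative D) (at 0) \<Longrightarrow> inj D"
  shows "quasi_trivial_C1_centralizer M \<Phi>"
  unfolding quasi_trivial_C1_centralizer_def
proof
  fix \<Psi> assume cent: "\<Psi> \<in> C1_centralizer M \<Phi>"
  note \<Psi> = C1_centralizerD(1)[OF cent] and commute = C1_centralizerD(2)[OF cent]
  have "\<exists>r>0. \<forall>x\<in>M. \<forall>v. norm v < r \<longrightarrow> \<Phi> (v, x) = x \<longrightarrow> v = 0"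
    by (rule uniformly_locally_free[OF M \<Phi>]) (rule free)
  then obtain r where r: "r > 0" "\<And>x v. x \<in> M \<Longrightarrow> norm v < r \<Longrightarrow> \<Phi> (v, x) = x \<Longrightarrow> v = 0"
    by metis
  have unique: "a = b" if x: "x \<in> M" and ab: "norm a < r / 2" "norm b < r / 2"
    and eq: "\<Phi> (a, x) = \<Phi> (b, x)" for a b x
  proof -
    have "\<Phi> (a - b, \<Phi> (b, x)) = \<Phi> (b, x)"
      using C1_action_add[OF \<Phi> x, of "a - b" b] eq by simp
    moreover have "norm (a - b) < r"
      using ab norm_triangle_ineq4[of a b] by simp
    ultimately show "a = b"
      using r(2)[OF C1_action_mem[OF \<Phi> x]] by fastforce
  qed
  \<comment> \<open>Below \<open>\<epsilon>\<close>, doubled times still lie within the radius of uniqueness \<open>r / 2\<close>.\<close>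
  define \<epsilon> where "\<epsilon> = r / 4"
  have "\<epsilon> > 0"
    using r(1) by (simp add: \<epsilon>_def)
  from centralizer_moves_along_orbits[OF M \<Phi> exp cent this]
  obtain \<rho> where \<rho>: "\<rho> > 0"
    "\<And>x u. x \<in> M \<Longrightarrow> norm u < \<rho> \<Longrightarrow> \<exists>v. norm v < \<epsilon> \<and> \<Psi> (u, x) = \<Phi> (v, x)"
    by metis
  define \<alpha> where "\<alpha> u x = (SOME v. norm v < \<epsilon> \<and> \<Psi> (u, x) = \<Phi> (v, x))" for u x
  have \<alpha>: "norm (\<alpha> u x) < \<epsilon>" "\<Psi> (u, x) = \<Phi> (\<alpha> u x, x)" if "x \<in> M" "norm u < \<rho>" for u x
    using someI_ex[OF \<rho>(2)[OF that]] unfolding \<alpha>_def by auto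
  have \<alpha>_eqI: "\<alpha> u x = v" if "x \<in> M" "norm u < \<rho>" "norm v < r / 2" "\<Psi> (u, x) = \<Phi> (v, x)" for u v x
    using \<alpha>[OF that(1,2)] that r(1) by (intro unique[OF that(1)]) (auto simp: \<epsilon>_def)
  have \<alpha>_half: "\<alpha> u x = 2 *\<^sub>R \<alpha> ((1/2) *\<^sub>R u) x" if x: "x \<in> M" and u: "norm u < \<rho>" for u x
  proof (rule \<alpha>_eqI[OF x u])
    define w where "w = (1/2::real) *\<^sub>R u"
    have w: "norm w < \<rho>"
      using u by (simp add: w_def) (smt (verit) norm_ge_zero)
    have "u = w + w"
      by (simp add: w_def flip: scaleR_add_left)
    then have "\<Psi> (u, x) = \<Psi> (w, \<Psi> (w, x))"
      using C1_action_add[OF \<Psi> x, of w w] by simp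
    also have "\<dots> = \<Phi> (\<alpha> w x, \<Psi> (w, x))"
      using commute[OF x, of w "\<alpha> w x"] \<alpha>(2)[OF x w] by simp
    also have "\<dots> = \<Phi> (2 *\<^sub>R \<alpha> w x, x)"
      using C1_action_add[OF \<Phi> x, of "\<alpha> w x" "\<alpha> w x"] \<alpha>(2)[OF x w] by (simp add: scaleR_2)
    finally show "\<Psi> (u, x) = \<Phi> (2 *\<^sub>R \<alpha> ((1/2) *\<^sub>R u) x, x)"
      by (simp add: w_def)
    show "norm (2 *\<^sub>R \<alpha> ((1/2) *\<^sub>R u) x) < r / 2"
      using \<alpha>(1)[OF x w] by (simp add: w_def \<epsilon>_def)
  qed
  have \<alpha>_invariant: "\<alpha> u (\<Phi> (v, x)) = \<alpha> u x" if x: "x \<in> M" and u: "norm u < \<rho>" for u v x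
  proof (rule \<alpha>_eqI[OF C1_action_mem[OF \<Phi> x] u])
    show "norm (\<alpha> u x) < r / 2"
      using \<alpha>(1)[OF x u] r(1) by (simp add: \<epsilon>_def)
    show "\<Psi> (u, \<Phi> (v, x)) = \<Phi> (\<alpha> u x, \<Phi> (v, x))"
      using commute[OF x, of u v] \<alpha>(2)[OF x u] C1_action_add[OF \<Phi> x, of v "\<alpha> u x"]
        C1_action_add[OF \<Phi> x, of "\<alpha> u x" v] by (simp add: add.commute)
  qed
  have \<alpha>_small: "\<exists>s>0. s \<le> \<rho> \<and> (\<forall>x\<in>M. \<forall>u. norm u < s \<longrightarrow> norm (\<alpha> u x) < \<eta>)" if "\<eta> > 0" for \<eta>
  proof -
    obtain k where k: "(1/2) ^ k < \<eta> / \<epsilon>"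
      using real_arch_pow_inv[of "\<eta> / \<epsilon>" "1/2"] \<open>\<eta> > 0\<close> \<open>\<epsilon> > 0\<close> by auto
    have "norm (\<alpha> u x) < \<eta>" if x: "x \<in> M" and u: "norm u < \<rho> / 2 ^ k" for x u
    proof -
      have *: "norm ((2::real) ^ k *\<^sub>R u) < \<rho>"
        using u by (simp add: field_simps)
      have "\<alpha> (2 ^ k *\<^sub>R u) x = 2 ^ k *\<^sub>R \<alpha> ((1/2) ^ k *\<^sub>R 2 ^ k *\<^sub>R u) x"
        using halving_iterate[where f = "\<lambda>u. \<alpha> u x" and \<rho> = \<rho>, OF \<alpha>_half[OF x] *] .
      then have "\<alpha> (2 ^ k *\<^sub>R u) x = 2 ^ k *\<^sub>R \<alpha> u x"
        by (simp add: power_one_over)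
      then have "2 ^ k * norm (\<alpha> u x) < \<epsilon>"
        using \<alpha>(1)[OF x *] by simp
      then have "norm (\<alpha> u x) < (1/2) ^ k * \<epsilon>"
        by (simp add: field_simps)
      also have "\<dots> < \<eta>"
        using k \<open>\<epsilon> > 0\<close> by (simp add: field_simps)
      finally show ?thesis .
    qed
    moreover have "\<rho> / 2 ^ k \<le> \<rho>"
      using \<rho>(1) by (simp add: field_simps)
    ultimately show ?thesis
      using \<rho>(1) by (intro exI[of _ "\<rho> / 2 ^ k"]) auto
  qed
  have \<alpha>_C1: "\<exists>s W a. 0 < s \<and> s \<le> \<rho> \<and> C1_on_open W a \<and>
      (\<forall>u y. norm u < s \<longrightarrow> dist y x < s \<longrightarrow> (u, y) \<in> W \<and> (y \<in> M \<longrightarrow> \<alpha> u y = a (u, y)))"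
    if x: "x \<in> M" for x
  proof -
    obtain t V and \<tau> :: "'a \<times> 'a \<Rightarrow> real ^ 'd" where \<tau>: "t > 0" "C1_on_open V \<tau>" "(x, x) \<in> V"
      "\<And>v y. y \<in> M \<Longrightarrow> norm v < t \<Longrightarrow> dist y x < t \<Longrightarrow> \<tau> (\<Phi> (v, y), y) = v"
      using local_time_function[OF \<Phi> x free[OF x]] by metis
    obtain U G where U: "C1_on_open U G" "(0, x) \<in> U"
      "\<And>u y. y \<in> M \<Longrightarrow> (u, y) \<in> U \<Longrightarrow> G (u, y) = \<Psi> (u, y)"
      using C1_action_extension[OF \<Psi> x] by metis
    have "open U" "open V"
      using U(1) \<tau>(2) by (auto simp: C1_on_open_def)
    then have C1: "C1_on_open U (\<lambda>z. (G z, snd z))"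
      by (intro C1_on_open_Pair U(1) C1_on_open_linear linear_snd)
    define W where "W = U \<inter> (\<lambda>z. (G z, snd z)) -` V"
    have "open W"
      unfolding W_def
      using continuous_open_preimage[OF C1_on_open_continuous[OF C1] \<open>open U\<close> \<open>open V\<close>] .
    then have C1a: "C1_on_open W (\<lambda>z. \<tau> (G z, snd z))"
      by (rule C1_on_open_compose[OF C1 \<tau>(2)]) (auto simp: W_def)
    have "(0, x) \<in> W"
      using U(2,3) x C1_action_zero[OF \<Psi> x] \<tau>(3) by (simp add: W_def)
    then obtain s where s: "s > 0" "\<forall>u y. dist u 0 < s \<longrightarrow> dist y x < s \<longrightarrow> (u, y) \<in> W"
      using open_contains_box[OF \<open>open W\<close>] by blast
    obtain s' where s': "s' > 0" "s' \<le> \<rho>" "\<forall>y\<in>M. \<forall>u. norm u < s' \<longrightarrow> norm (\<alpha> u y) < t"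
      using \<alpha>_small[OF \<tau>(1)] by blast
    define q where "q = min s (min s' t)"
    have "(u, y) \<in> W \<and> (y \<in> M \<longrightarrow> \<alpha> u y = \<tau> (G (u, y), snd (u, y)))"
      if u: "norm u < q" and y: "dist y x < q" for u y
    proof (intro conjI impI)
      show W: "(u, y) \<in> W"
        using s(2) u y by (simp add: q_def)
      assume "y \<in> M"
      moreover have "G (u, y) = \<Psi> (u, y)"
        using W U(3) \<open>y \<in> M\<close> by (simp add: W_def)
      ultimately show "\<alpha> u y = \<tau> (G (u, y), snd (u, y))"
        using \<tau>(4)[of y "\<alpha> u y"] \<alpha>(2)[of y u] s'(2,3) u y by (simp add: q_def)
    qed
    moreover have "0 < q" "q \<le> \<rho>"
      using s(1) s'(1,2) \<tau>(1) by (auto simp: q_def)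
    ultimately show ?thesis
      using C1a by (intro exI[of _ q] exI[of _ W] exI[of _ "\<lambda>z. \<tau> (G z, snd z)"]) blast
  qed
  have "\<exists>D. linear D \<and> (\<forall>u. norm u < \<rho> \<longrightarrow> \<alpha> u x = D u)" if x: "x \<in> M" for x
  proof -
    obtain s W a where a: "0 < s" "C1_on_open W a"
      "\<And>u. norm u < s \<Longrightarrow> (u, x) \<in> W \<and> \<alpha> u x = a (u, x)"
      using \<alpha>_C1[OF x] x by (metis dist_self)
    obtain D where D: "(a has_derivative D) (at (0, x))"
      using a(1) a(3)[of 0] C1_on_openE[OF a(2)] by (metis norm_zero)
    have "((\<lambda>u. (u, x)) has_derivative (\<lambda>h. (h, 0))) (at 0)"
      by (auto intro!: derivative_eq_intros)
    from has_derivative_compose[OF this D]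
    have "((\<lambda>u. a (u, x)) has_derivative (\<lambda>h. D (h, 0))) (at 0)" .
    then have "((\<lambda>u. \<alpha> u x) has_derivative (\<lambda>h. D (h, 0))) (at 0)"
      by (rule has_derivative_transform_within_open[where s = "ball 0 s"]) (use a in auto)
    then show ?thesis
      using halving_eq_derivative[where f = "\<lambda>u. \<alpha> u x", OF \<alpha>_half[OF x]] has_derivative_linear
      by blast
  qed
  then obtain L where L: "\<And>x. x \<in> M \<Longrightarrow> linear (L x)"
    "\<And>x u. x \<in> M \<Longrightarrow> norm u < \<rho> \<Longrightarrow> \<alpha> u x = L x u"
    by metis
  define A where "A x = matrix (L x)" for x
  have A: "A x *v u = L x u" if "x \<in> M" for x u
    using matrix_vector_mul(2)[OF L(1)[OF that]] unfolding A_def by metis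
  \<comment> \<open>The columns of \<open>A\<close> are multiples of values of \<open>\<alpha>\<close>, so that \<open>A\<close> inherits both its
    invariance and its smoothness in \<open>x\<close>.\<close>
  have A_eq: "A x $ i $ j = (1 / s) *\<^sub>R \<alpha> (s *\<^sub>R axis j 1) x $ i"
    if "x \<in> M" "0 < s" "s < \<rho>" for x s i j
    using L(2)[OF that(1), of "s *\<^sub>R axis j 1"] linear_cmul[OF L(1)[OF that(1)]] that(2,3)
    by (simp add: A_def matrix_def)
  have "C1_map M UNIV A"
    unfolding C1_map_def
  proof (intro conjI ballI)
    fix x assume x: "x \<in> M"
    obtain s W a where a: "0 < s" "s \<le> \<rho>" "C1_on_open W a"
      "\<And>u y. norm u < s \<Longrightarrow> dist y x < s \<Longrightarrow> (u, y) \<in> W \<and> (y \<in> M \<longrightarrow> \<alpha> u y = a (u, y))"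
      using \<alpha>_C1[OF x] by metis
    define e where "e j = (s / 2) *\<^sub>R (axis j 1 :: real ^ 'd)" for j
    have e: "norm (e j) < s" for j
      using a(1) by (simp add: e_def)
    define col :: "'d \<Rightarrow> real ^ 'd \<Rightarrow> real ^ 'd ^ 'd"
      where "col j w = (\<chi> i k. if k = j then (2 / s) * w $ i else 0)" for j w
    have lincol: "linear (col j)" for j
      by (rule linearI) (auto simp: col_def vec_eq_iff algebra_simps)
    have pair: "C1_on_open (ball x s) (\<lambda>y. (e j, y))" for j
      by (intro C1_on_open_Pair C1_on_open_const C1_on_open_linear linear_ident open_ball)
    have "C1_on_open (ball x s) (\<lambda>y. a (e j, y))" for j
      by (rule C1_on_open_compose[OF pair a(3)]) (use a(4)[OF e] in \<open>auto simp: dist_commute\<close>)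
    then have "C1_on_open (ball x s) (\<lambda>y. \<Sum>j\<in>UNIV. col j (a (e j, y)))"
      by (intro C1_on_open_sum open_ball C1_on_open_linear_compose[OF _ lincol])
    moreover have "(\<Sum>j\<in>UNIV. col j (a (e j, y))) = A y" if "y \<in> M \<inter> ball x s" for y
    proof -
      have "a (e j, y) = \<alpha> (e j) y" for j
        using a(4)[OF e, of y j] that by (simp add: dist_commute)
      moreover have "A y $ i $ k = (2 / s) * \<alpha> (e k) y $ i" for i k
        using A_eq[of y "s / 2" i k] that a(1,2) by (simp add: e_def)
      ultimately show ?thesis
        by (simp add: vec_eq_iff col_def)
    qed
    moreover have "x \<in> ball x s"
      using a(1) by simp
    ultimately show "\<exists>U F. x \<in> U \<and> C1_on_open U F \<and> (\<forall>y\<in>M \<inter> U. F y = A y)"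
      by blast
  qed simp
  moreover have "A x = A (\<Phi> (v, x))" if x: "x \<in> M" for v x
  proof -
    have s: "0 < \<rho> / 2" "\<rho> / 2 < \<rho>"
      using \<rho>(1) by auto
    have "norm ((\<rho> / 2) *\<^sub>R (axis j 1 :: real ^ 'd)) < \<rho>" for j
      using \<rho>(1) by simp
    from \<alpha>_invariant[OF x this] have "A x $ i $ j = A (\<Phi> (v, x)) $ i $ j" for i j
      unfolding A_eq[OF x s] A_eq[OF C1_action_mem[OF \<Phi> x] s] by simp
    then show ?thesis
      by (simp add: vec_eq_iff)
  qed
  moreover have "\<Psi> (v, x) = \<Phi> (A x *v v, x)" if x: "x \<in> M" for v x
  proof -
    have "norm v < 2 ^ k * \<rho> \<Longrightarrow> \<Psi> (v, x) = \<Phi> (L x v, x)" for k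
    proof (induction k arbitrary: v)
      case 0
      then show ?case
        using \<alpha>(2)[OF x] L(2)[OF x] by simp
    next
      case (Suc k)
      define w where "w = (1/2::real) *\<^sub>R v"
      have v: "v = w + w"
        by (simp add: w_def flip: scaleR_add_left)
      have w: "\<Psi> (w, x) = \<Phi> (L x w, x)"
        using Suc by (simp add: w_def)
      have "\<Psi> (v, x) = \<Phi> (L x w, \<Phi> (L x w, x))"
        using C1_action_add[OF \<Psi> x, of w w] commute[OF x, of w "L x w"] v w by simp
      also have "\<dots> = \<Phi> (L x v, x)"
        using C1_action_add[OF \<Phi> x, of "L x w" "L x w"] linear_add[OF L(1)[OF x], of w w]
        unfolding v by simp
      finally show ?case .
    qed
    moreover obtain k where "norm v / \<rho> < 2 ^ k"
      using real_arch_pow[of 2] by auto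
    ultimately show ?thesis
      using \<rho>(1) A[OF x] by (metis pos_divide_less_eq)
  qed
  ultimately show "\<exists>A. C1_map M UNIV A \<and> (\<forall>v. \<forall>x\<in>M. A x = A (\<Phi> (v, x))) \<and>
      (\<forall>v. \<forall>x\<in>M. \<Psi> (v, x) = \<Phi> (A x *v v, x))"
    by (intro exI[of _ A]) blast
qed

section \<open>Actions on the torus\<close>

lemma compact_torus: "compact (torus :: (complex ^ 'n) set)"
proof -
  have "torus = (\<Inter>i. (\<lambda>z::complex ^ 'n. norm (z $ i)) -` {1})"
    by (auto simp: torus_def)
  moreover have "closed (\<Inter>i. (\<lambda>z::complex ^ 'n. norm (z $ i)) -` {1})"
    by (intro closed_INT ballI closed_vimage continuous_intros)
  ultimately have "closed (torus :: (complex ^ 'n) set)"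
    by simp
  moreover have "norm z \<le> real CARD('n)" if "z \<in> torus" for z :: "complex ^ 'n"
    using L2_set_le_sum[of UNIV "\<lambda>i. norm (z $ i)"] that by (simp add: torus_def norm_vec_def)
  ultimately show ?thesis
    unfolding compact_eq_bounded_closed bounded_iff by blast
qed

theorem theorem2p2:
  fixes \<Phi> :: "(real ^ 'd) \<times> (complex ^ 'n) \<Rightarrow> complex ^ 'n"
  assumes "CARD('d) \<le> CARD('n)"
    and "C1_action torus \<Phi>"
    and "expansive torus \<Phi>"
    and "homogeneous torus \<Phi>"
  shows "quasi_trivial_C1_centralizer torus \<Phi>"
proof (rule expansive_locally_free_quasi_trivial_centralizer[OF compact_torus assms(2,3)])
  fix x :: "complex ^ 'n" and D
  assume "x \<in> torus" "((\<lambda>v. \<Phi> (v, x)) has_derivative D) (at 0)"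
  then show "inj D"
    using orbit_map_derivative_inj[OF assms(2)] assms(4) unfolding homogeneous_def by blast
qed

end
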